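(* Let $\theta:\mathbb{R}\to\mathbb{R}$ be smooth, even, and decreasing away from the origin (i.e. decreasing on $(0,\infty)$). Then for any $0<x_2<x_1$, $$\int_{x_2}^{x_1}H\theta\,\partial_x\theta\,dx\ \ge\ \frac1{4\pi}\log\left(\frac{x_1+x_2}{x_1-x_2}\right)(\theta(x_2)-\theta(x_1))^2.$$
   Context: $H$ is the Hilbert transform $H\theta(x)=\frac1\pi\,\mathrm{p.v.}\int_{\mathbb{R}}\frac{\theta(y)}{y-x}\,dy$, assumed well defined for $\theta$; for even $\theta$ it is given by $H\theta(x)=\frac{2x}{\pi}\int_0^\infty\frac{\theta(y)-\theta(x)}{y^2-x^2}\,dy$. *)

theory Defs
  imports "HOL-Analysis.Analysis"
begin

definition smooth :: "(real \<Rightarrow> real) \<Rightarrow> bool" where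
  "smooth f \<longleftrightarrow> (\<forall>n x. (deriv ^^ n) f differentiable (at x))"

definition hilbert_trunc :: "(real \<Rightarrow> real) \<Rightarrow> real \<Rightarrow> real \<Rightarrow> real \<Rightarrow> real" where
  "hilbert_trunc \<theta> x \<epsilon> R =
     (1 / pi) * (LBINT y:{y. \<epsilon> < \<bar>y - x\<bar> \<and> \<bar>y - x\<bar> < R}. \<theta> y / (y - x))"

text \<open>The principal value is a symmetric limit both at the singularity and at infinity, the two
  cutoffs being sent to their limits independently. No decay of the function is required: constants,
  for instance, have Hilbert transform zero. For an even function this symmetric convention is the
  one that matches \<open>(2 * x / pi)\<close> times the integral of
  \<open>(\<theta> y - \<theta> x) / (y\<^sup>2 - x\<^sup>2)\<close> over the positive half-line. If the tails are integrable, the outer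
  cutoff is immaterial.\<close>

definition has_hilbert_transform :: "(real \<Rightarrow> real) \<Rightarrow> real \<Rightarrow> real \<Rightarrow> bool" where
  "has_hilbert_transform \<theta> h x \<longleftrightarrow>
     ((\<lambda>(\<epsilon>, R). hilbert_trunc \<theta> x \<epsilon> R) \<longlongrightarrow> h) (at_right 0 \<times>\<^sub>F at_top)"

definition hilbert_transform :: "(real \<Rightarrow> real) \<Rightarrow> real \<Rightarrow> real" where
  "hilbert_transform \<theta> x = (THE h. has_hilbert_transform \<theta> h x)"

definition hilbert_well_defined :: "(real \<Rightarrow> real) \<Rightarrow> bool" where
  "hilbert_well_defined \<theta> \<longleftrightarrow> (\<forall>x. \<exists>h. has_hilbert_transform \<theta> h x)"

end

theory Submission
  imports Defs
begin

text \<open>Folding the principal value gives \<open>- \<pi> H\<theta>(x) = \<integral> (\<theta> (x - t) - \<theta> (x + t)) / t dt\<close> over \<open>t > 0\<close>, whose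
  integrand is nonnegative when \<open>x \<ge> 0\<close>. Writing the numerator as an integral of \<open>- \<theta>'\<close> and exchanging
  the integrals yields \<open>\<integral> - \<theta>' z ln ((z + x) / \<bar>z - x\<bar>) dz\<close> over \<open>z > 0\<close>. For \<open>x\<close> and \<open>z\<close> in
  \<open>{x2..x1}\<close> the logarithm is at least \<open>ln ((x1 + x2) / (x1 - x2))\<close>, which bounds \<open>- \<pi> H\<theta>(x)\<close> from below
  uniformly in \<open>x\<close>; multiplying by \<open>- \<theta>' x \<ge> 0\<close> and integrating gives the claim, even with \<open>1 / \<pi>\<close> in
  place of \<open>1 / (4 \<pi>)\<close>. Since a non-integrable function has Bochner integral \<open>0\<close>, boundedness of \<open>H\<theta>\<close>
  on \<open>{x2..x1}\<close> is needed as well.\<close>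

section \<open>Folding the truncated transform; measurability of the limit\<close>

definition sym_quot :: "(real \<Rightarrow> real) \<Rightarrow> real \<Rightarrow> real \<Rightarrow> real" where
  "sym_quot \<theta> x t = (\<theta> (x - t) - \<theta> (x + t)) / t"

lemma set_integrable_greaterThanLessThan:
  fixes f :: "real \<Rightarrow> real"
  assumes "continuous_on {a..b} f"
  shows "set_integrable lborel {a<..<b} f"
  by (rule set_integrable_subset[OF borel_integrable_atLeastAtMost'[OF assms]]) auto

lemma continuous_on_translate:
  fixes \<theta> :: "real \<Rightarrow> real"
  assumes "continuous_on UNIV \<theta>"
  shows "continuous_on A (\<lambda>t. \<theta> (x + t))" "continuous_on A (\<lambda>t. \<theta> (x - t))"
  by (rule continuous_on_compose2[OF assms], (intro continuous_intros), rule subset_UNIV)+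

lemma set_integrable_sym_quot:
  assumes "continuous_on UNIV \<theta>" "0 < \<epsilon>"
  shows "set_integrable lborel {\<epsilon><..<R} (sym_quot \<theta> x)"
  unfolding sym_quot_def using assms(2)
  by (intro set_integrable_greaterThanLessThan continuous_on_divide continuous_on_diff
        continuous_on_translate[OF assms(1)] continuous_on_id) simp

text \<open>The shift \<open>y = x + t\<close> turns the truncation region into two symmetric
  intervals, and reflecting the negative one changes \<open>\<theta> (x + t) / t\<close> into
  \<open>- (\<theta> (x - t) / t)\<close>.\<close>

lemma hilbert_trunc_eq_sym_quot:
  assumes cont: "continuous_on UNIV \<theta>" and "0 < \<epsilon>"
  shows "hilbert_trunc \<theta> x \<epsilon> R = - (1 / pi) * (LBINT t:{\<epsilon><..<R}. sym_quot \<theta> x t)"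
proof -
  let ?P = "{\<epsilon><..<R}" and ?N = "{-R<..<-\<epsilon>}" and ?f = "\<lambda>t. \<theta> (x + t) / t"
  have P: "set_integrable lborel ?P ?f" and N: "set_integrable lborel ?N ?f"
    and P': "set_integrable lborel ?P (\<lambda>t. \<theta> (x - t) / t)"
    using \<open>0 < \<epsilon>\<close>
    by (intro set_integrable_greaterThanLessThan continuous_on_divide
          continuous_on_translate[OF cont] continuous_on_id; simp)+
  have "(LBINT y:{y. \<epsilon> < \<bar>y - x\<bar> \<and> \<bar>y - x\<bar> < R}. \<theta> y / (y - x)) = (LBINT t:?P \<union> ?N. ?f t)"
    unfolding set_lebesgue_integral_def using \<open>0 < \<epsilon>\<close>
    by (subst lborel_integral_real_affine[where c=1 and t=x])
       (auto intro!: Bochner_Integration.integral_cong split: split_indicator)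
  also have "\<dots> = (LBINT t:?P. ?f t) + (LBINT t:?N. ?f t)"
    using \<open>0 < \<epsilon>\<close> by (intro set_integral_Un P N) auto
  also have "(LBINT t:?N. ?f t) = (LBINT t:?P. - (\<theta> (x - t) / t))"
    by (subst set_integral_reflect)
       (auto simp: set_lebesgue_integral_def intro!: Bochner_Integration.integral_cong
         split: split_indicator)
  also have "(LBINT t:?P. ?f t) + \<dots> = (LBINT t:?P. - sym_quot \<theta> x t)"
    unfolding sym_quot_def
    by (subst set_integral_add(2)[symmetric])
       (use P P' in \<open>auto simp: diff_divide_distrib set_integrable_def\<close>)
  also have "\<dots> = - (LBINT t:?P. sym_quot \<theta> x t)"
    by (simp add: set_lebesgue_integral_def)
  finally show ?thesis
    by (simp add: hilbert_trunc_def)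
qed

lemma has_hilbert_transform_unique:
  assumes "has_hilbert_transform \<theta> h x" "has_hilbert_transform \<theta> h' x"
  shows "h = h'"
  using assms unfolding has_hilbert_transform_def
  by (intro tendsto_unique[where F = "at_right (0::real) \<times>\<^sub>F at_top"])
     (auto simp: prod_filter_eq_bot)

lemma has_hilbert_transform_hilbert_transform:
  assumes "hilbert_well_defined \<theta>"
  shows "has_hilbert_transform \<theta> (hilbert_transform \<theta> x) x"
  using assms unfolding hilbert_transform_def hilbert_well_defined_def
  by (metis has_hilbert_transform_unique theI')

lemma hilbert_transform_limit:
  assumes "continuous_on UNIV \<theta>" "hilbert_well_defined \<theta>"
  shows "((\<lambda>(\<epsilon>, R). LBINT t:{\<epsilon><..<R}. sym_quot \<theta> x t) \<longlongrightarrow> - pi * hilbert_transform \<theta> x)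
           (at_right 0 \<times>\<^sub>F at_top)"
proof -
  have "((\<lambda>p. - pi * (case p of (\<epsilon>, R) \<Rightarrow> hilbert_trunc \<theta> x \<epsilon> R)) \<longlongrightarrow>
           - pi * hilbert_transform \<theta> x) (at_right 0 \<times>\<^sub>F at_top)"
    using has_hilbert_transform_hilbert_transform[OF assms(2), of x]
    unfolding has_hilbert_transform_def by (intro tendsto_intros)
  moreover have "\<forall>\<^sub>F p in at_right 0 \<times>\<^sub>F at_top.
      - pi * (case p of (\<epsilon>, R) \<Rightarrow> hilbert_trunc \<theta> x \<epsilon> R) =
      (case p of (\<epsilon>, R) \<Rightarrow> LBINT t:{\<epsilon><..<R}. sym_quot \<theta> x t)"
    unfolding eventually_prod_filter
    by (intro exI[of _ "\<lambda>\<epsilon>. 0 < \<epsilon>"] exI[of _ "\<lambda>_. True"])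
       (auto simp: eventually_at_right_less hilbert_trunc_eq_sym_quot[OF assms(1)])
  ultimately show ?thesis
    by (rule Lim_transform_eventually)
qed

text \<open>Restricting the two-parameter limit to a sequence of cutoffs makes the transform a
  pointwise limit of parameter integrals, each measurable in \<open>x\<close>.\<close>

lemma borel_measurable_hilbert_transform:
  assumes "continuous_on UNIV \<theta>" "hilbert_well_defined \<theta>"
  shows "hilbert_transform \<theta> \<in> borel_measurable borel"
proof -
  have [measurable]: "\<theta> \<in> borel_measurable borel"
    using assms(1) by (rule borel_measurable_continuous_onI)
  let ?J = "\<lambda>n x. LBINT t:{inverse (real (Suc n))<..<real n}. sym_quot \<theta> x t"
  have lim: "(\<lambda>n. ?J n x) \<longlonglongrightarrow> - pi * hilbert_transform \<theta> x" for x
  proof -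
    have "filterlim (\<lambda>n. inverse (real (Suc n))) (at_right 0) sequentially"
      by (rule tendsto_imp_filterlim_at_right[OF LIMSEQ_inverse_real_of_nat]) auto
    then have "filterlim (\<lambda>n. (inverse (real (Suc n)), real n)) (at_right 0 \<times>\<^sub>F at_top) sequentially"
      by (intro filterlim_Pair filterlim_real_sequentially)
    from filterlim_compose[OF hilbert_transform_limit[OF assms] this] show ?thesis
      by simp
  qed
  have "(\<lambda>x. LBINT t:{a<..<b}. sym_quot \<theta> x t) \<in> borel_measurable borel" for a b
    unfolding set_lebesgue_integral_def sym_quot_def
    by (rule lborel.borel_measurable_lebesgue_integral) measurable
  then have "(\<lambda>x. - pi * hilbert_transform \<theta> x) \<in> borel_measurable borel"
    by (rule borel_measurable_LIMSEQ_real[where u = ?J, OF lim])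
  then have "(\<lambda>x. - (1 / pi) * (- pi * hilbert_transform \<theta> x)) \<in> borel_measurable borel"
    by (rule borel_measurable_times[OF borel_measurable_const])
  then show ?thesis by simp
qed

section \<open>Monotonicity and sign consequences\<close>

locale even_decreasing =
  fixes \<theta> \<theta>' :: "real \<Rightarrow> real"
  assumes deriv: "\<And>x. (\<theta> has_real_derivative \<theta>' x) (at x)"
    and cont': "continuous_on UNIV \<theta>'"
    and even: "\<And>x. \<theta> (- x) = \<theta> x"
    and antimono: "antimono_on {0<..} \<theta>"
begin

lemma cont: "continuous_on UNIV \<theta>"
  using deriv by (auto intro!: DERIV_isCont simp: continuous_on_eq_continuous_at)

lemma antimono_abs:
  assumes "\<bar>x\<bar> \<le> \<bar>y\<bar>"
  shows "\<theta> y \<le> \<theta> x"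
proof -
  have abs: "\<theta> \<bar>z\<bar> = \<theta> z" for z
    by (auto simp: abs_if even)
  have pos: "\<theta> b \<le> \<theta> a" if "0 < a" "a \<le> b" for a b
    using monotone_onD[OF antimono, of a b] that by auto
  \<comment> \<open>The assumption concerns the open half-line, so comparison with the value at the
    origin comes from right continuity.\<close>
  have "\<theta> b \<le> \<theta> 0" if "0 < b" for b
  proof (rule tendsto_lowerbound)
    show "(\<theta> \<longlongrightarrow> \<theta> 0) (at_right 0)"
      using DERIV_isCont[OF deriv, of 0] by (simp add: isCont_def filterlim_at_split)
    show "\<forall>\<^sub>F a in at_right 0. \<theta> b \<le> \<theta> a"
      using eventually_at_right_less[of 0] eventually_at_right_real[OF that]
      by eventually_elim (auto intro: pos)
  qed auto
  with pos[of "\<bar>x\<bar>" "\<bar>y\<bar>"] assms have "\<theta> \<bar>y\<bar> \<le> \<theta> \<bar>x\<bar>"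
    by (cases "x = 0"; cases "y = 0") auto
  then show ?thesis by (simp add: abs)
qed

lemma deriv_nonpos:
  assumes "0 < x"
  shows "\<theta>' x \<le> 0"
proof -
  have "mono_on {0<..} (\<lambda>x. - \<theta> x)"
    using antimono by (auto simp: monotone_on_def)
  moreover have "((\<lambda>x. - \<theta> x) has_real_derivative - \<theta>' x) (at x)"
    by (intro derivative_intros deriv)
  ultimately have "0 \<le> - \<theta>' x"
    by (rule mono_on_imp_deriv_nonneg) (use assms in \<open>auto simp: interior_open\<close>)
  then show ?thesis by simp
qed

lemma sym_quot_nonneg:
  assumes "0 \<le> x" "0 < t"
  shows "0 \<le> sym_quot \<theta> x t"
  using antimono_abs[of "x - t" "x + t"] assms by (auto simp: sym_quot_def)

text \<open>Stated for the nonnegative integral so that Tonelli can be applied directly;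
  \<open>0 < a\<close> keeps the interval where \<open>- \<theta>'\<close> is nonnegative.\<close>

lemma nn_integral_deriv:
  assumes "0 < a" "a \<le> b"
  shows "(\<integral>\<^sup>+z. ennreal (- \<theta>' z) * indicator {a..b} z \<partial>lborel) = ennreal (\<theta> a - \<theta> b)"
proof -
  have [measurable]: "\<theta>' \<in> borel_measurable borel"
    using cont' by (rule borel_measurable_continuous_onI)
  have "((\<lambda>z. - \<theta> z) has_real_derivative - \<theta>' z) (at z)" for z
    by (intro derivative_intros deriv)
  then have "(\<integral>\<^sup>+z. ennreal (- \<theta>' z) * indicator {a..b} z \<partial>lborel) = ennreal (- \<theta> b - (- \<theta> a))"
    using assms deriv_nonpos
    by (intro nn_integral_FTC_Icc) (auto intro: has_field_derivative_at_within)
  then show ?thesis by simp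
qed

text \<open>Tonelli applied to \<open>\<theta> (x - t) - \<theta> (x + t) \<ge> \<integral> - \<theta>' z dz\<close> over \<open>\<bar>x - t\<bar> \<le> z \<le> x + t\<close>, a condition
  equivalent to \<open>\<bar>x - z\<bar> \<le> t \<le> x + z\<close>; the interval \<open>{(x + z) / \<rho>..x + z}\<close>, where
  \<open>\<rho> = (x1 + x2) / (x1 - x2)\<close>, lies in that range of \<open>t\<close> whenever \<open>x\<close> and \<open>z\<close> are in \<open>{x2..x1}\<close>.\<close>

lemma integral_sym_quot_ge:
  assumes "0 < x2" "x2 < x1" "x2 \<le> x" "x \<le> x1"
    and "0 < \<epsilon>" "\<epsilon> < 2 * x2 * (x1 - x2) / (x1 + x2)" "2 * x1 < R"
  shows "ln ((x1 + x2) / (x1 - x2)) * (\<theta> x2 - \<theta> x1) \<le> (LBINT t:{\<epsilon><..<R}. sym_quot \<theta> x t)"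
proof -
  have [measurable]: "\<theta>' \<in> borel_measurable borel"
    using cont' by (rule borel_measurable_continuous_onI)
  define L where "L = ln ((x1 + x2) / (x1 - x2))"
  have "0 \<le> L" using assms by (simp add: L_def)
  \<comment> \<open>\<open>r\<close> is the reciprocal of the ratio inside the logarithm. The cutoff
    \<open>\<epsilon>\<close> lies below \<open>2 * x2 * r\<close>, hence below
    \<open>(x + z) * r\<close> for all \<open>z\<close> in \<open>{x2..x1}\<close>.\<close>
  define r where "r = (x1 - x2) / (x1 + x2)"
  have r: "0 < r" "r \<le> 1" "\<epsilon> < 2 * x2 * r" using assms by (auto simp: r_def)
  \<comment> \<open>Cleared of denominators, the two sign cases say that two points of
    \<open>{x2..x1}\<close> have ratio at most \<open>x1 / x2\<close>.\<close>
  have r_bound: "\<bar>x - z\<bar> \<le> (x + z) * r" if "z \<in> {x2..x1}" for z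
  proof -
    have "x * x2 \<le> x1 * z" "z * x2 \<le> x1 * x"
      using that assms by (auto intro!: mult_mono)
    then have "\<bar>x - z\<bar> * (x1 + x2) \<le> (x + z) * (x1 - x2)"
      by (auto simp: abs_if algebra_simps)
    then show ?thesis using assms by (simp add: r_def field_simps)
  qed
  \<comment> \<open>The Tonelli kernel: \<open>inner_t\<close> reads the condition in the
    \<open>if\<close> as a range of \<open>t\<close>, \<open>inner_z\<close> as a range of
    \<open>z\<close>. Cutting \<open>z\<close> down to \<open>{x2..x1}\<close> only loses
    nonnegative mass.\<close>
  define k where "k = (\<lambda>t z. ennreal (- \<theta>' z) * indicator {x2..x1} z *
      (ennreal (1 / t) * indicator {\<epsilon><..<R} t * (if \<bar>x - t\<bar> \<le> z \<and> z \<le> x + t then 1 else 0)))"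
  have [measurable]: "case_prod k \<in> borel_measurable (lborel \<Otimes>\<^sub>M lborel)"
    unfolding k_def by measurable
  have inner_t: "(\<integral>\<^sup>+t. k t z \<partial>lborel) \<ge> ennreal L * (ennreal (- \<theta>' z) * indicator {x2..x1} z)" for z
  proof (cases "z \<in> {x2..x1}")
    case z: True
    define a where "a = (x + z) * r"
    have a: "\<bar>x - z\<bar> \<le> a" "0 < a" "a \<le> x + z"
      using r_bound[OF z] r z assms by (auto simp: a_def mult_le_cancel_left1)
    have "2 * x2 * r \<le> a" using z assms r by (auto simp: a_def intro!: mult_right_mono)
    then have "\<epsilon> < a" using r by simp
    \<comment> \<open>Since \<open>a\<close> is a fixed fraction of \<open>x + z\<close>,
      integrating \<open>1 / t\<close> from \<open>a\<close> to \<open>x + z\<close> gives the same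
      value \<open>L\<close> for every \<open>z\<close>.\<close>
    have "L = ln (x + z) - ln a"
      using assms z r unfolding a_def L_def r_def
      by (simp add: ln_mult ln_div)
    moreover have "(ln has_real_derivative 1 / t) (at t within A)" if "a \<le> t" for t A
      using DERIV_ln_divide[of t] that a by (auto intro: has_field_derivative_at_within)
    then have "(\<integral>\<^sup>+t. ennreal (1 / t) * indicator {a..x + z} t \<partial>lborel) = ennreal (ln (x + z) - ln a)"
      using a by (intro nn_integral_FTC_Icc) auto
    ultimately have "ennreal L = (\<integral>\<^sup>+t. ennreal (1 / t) * indicator {a..x + z} t \<partial>lborel)"
      by simp
    then have "ennreal L * (ennreal (- \<theta>' z) * indicator {x2..x1} z) =
        (\<integral>\<^sup>+t. ennreal (- \<theta>' z) * (ennreal (1 / t) * indicator {a..x + z} t) \<partial>lborel)"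
      using z by (simp add: nn_integral_cmult mult.commute)
    also have "\<dots> \<le> (\<integral>\<^sup>+t. k t z \<partial>lborel)"
    proof (rule nn_integral_mono)
      fix t
      have "\<epsilon> < t \<and> t < R \<and> \<bar>x - t\<bar> \<le> z \<and> z \<le> x + t" if "t \<in> {a..x + z}"
        using that z a(1) \<open>\<epsilon> < a\<close> assms(4,7) unfolding atLeastAtMost_iff by linarith
      then show "ennreal (- \<theta>' z) * (ennreal (1 / t) * indicator {a..x + z} t) \<le> k t z"
        using z by (cases "t \<in> {a..x + z}") (simp_all add: k_def)
    qed
    finally show ?thesis .
  qed auto
  have inner_z: "(\<integral>\<^sup>+z. k t z \<partial>lborel) \<le> ennreal (indicator {\<epsilon><..<R} t *\<^sub>R sym_quot \<theta> x t)" for t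
  proof (cases "t \<in> {\<epsilon><..<R}")
    case t: True
    \<comment> \<open>For this \<open>t\<close> the kernel lives on \<open>z\<close> in
      \<open>{?a..?b}\<close>, possibly empty. The maximum with \<open>x2\<close> keeps the left end
      positive even when \<open>t = x\<close>.\<close>
    let ?a = "max x2 \<bar>x - t\<bar>" and ?b = "min x1 (x + t)"
    have "(\<integral>\<^sup>+z. k t z \<partial>lborel) =
        ennreal (1 / t) * (\<integral>\<^sup>+z. ennreal (- \<theta>' z) * indicator {?a..?b} z \<partial>lborel)"
    proof (subst nn_integral_cmult[symmetric])
      have ac: "a * i * (c * p) = c * (a * (i * p))" for a i c p :: ennreal
        by (simp only: mult_ac)
      have set: "indicator {x2..x1} z * (if \<bar>x - t\<bar> \<le> z \<and> z \<le> x + t then 1 else 0) =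
          (indicator {?a..?b} z :: ennreal)" for z
        unfolding indicator_def atLeastAtMost_iff max.bounded_iff min.bounded_iff by simp
      have "k t z = ennreal (1 / t) * (ennreal (- \<theta>' z) * indicator {?a..?b} z)" for z
        unfolding k_def indicator_simps(1)[OF t] mult_1_right by (subst ac) (simp only: set)
      then show "(\<integral>\<^sup>+z. k t z \<partial>lborel) =
          (\<integral>\<^sup>+z. ennreal (1 / t) * (ennreal (- \<theta>' z) * indicator {?a..?b} z) \<partial>lborel)"
        by simp
    qed measurable
    moreover have "(\<integral>\<^sup>+z. ennreal (- \<theta>' z) * indicator {?a..?b} z \<partial>lborel) \<le>
        ennreal (\<theta> (x - t) - \<theta> (x + t))"
    proof (cases "?a \<le> ?b")
      case True
      have "\<theta> ?a \<le> \<theta> (x - t)" "\<theta> (x + t) \<le> \<theta> ?b"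
        using assms t by (intro antimono_abs; linarith)+
      moreover have "0 < ?a" using assms(1) by linarith
      ultimately show ?thesis
        unfolding nn_integral_deriv[OF \<open>0 < ?a\<close> True] by (intro ennreal_leI) linarith
    qed simp
    ultimately have "(\<integral>\<^sup>+z. k t z \<partial>lborel) \<le> ennreal (1 / t) * ennreal (\<theta> (x - t) - \<theta> (x + t))"
      by (simp only: mult_left_mono zero_le)
    also have "\<dots> = ennreal (sym_quot \<theta> x t)"
      using t assms(5) by (subst ennreal_mult'[symmetric]) (simp_all add: sym_quot_def)
    finally show ?thesis
      using t by simp
  qed (simp add: k_def)
  have int: "integrable lborel (\<lambda>t. indicator {\<epsilon><..<R} t *\<^sub>R sym_quot \<theta> x t)"
    using set_integrable_sym_quot[OF cont \<open>0 < \<epsilon>\<close>] by (simp add: set_integrable_def)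
  have nonneg: "0 \<le> indicator {\<epsilon><..<R} t *\<^sub>R sym_quot \<theta> x t" for t
    using assms sym_quot_nonneg[of x t] by (auto split: split_indicator)
  have "ennreal (L * (\<theta> x2 - \<theta> x1)) =
      (\<integral>\<^sup>+z. ennreal L * (ennreal (- \<theta>' z) * indicator {x2..x1} z) \<partial>lborel)"
    using assms \<open>0 \<le> L\<close> by (simp add: nn_integral_cmult nn_integral_deriv ennreal_mult')
  also have "\<dots> \<le> (\<integral>\<^sup>+z. (\<integral>\<^sup>+t. k t z \<partial>lborel) \<partial>lborel)"
    by (intro nn_integral_mono inner_t)
  also have "\<dots> = (\<integral>\<^sup>+t. (\<integral>\<^sup>+z. k t z \<partial>lborel) \<partial>lborel)"
    by (rule lborel_pair.Fubini') measurable
  also have "\<dots> \<le> (\<integral>\<^sup>+t. ennreal (indicator {\<epsilon><..<R} t *\<^sub>R sym_quot \<theta> x t) \<partial>lborel)"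
    by (intro nn_integral_mono inner_z)
  also have "\<dots> = ennreal (LBINT t:{\<epsilon><..<R}. sym_quot \<theta> x t)"
    unfolding set_lebesgue_integral_def by (intro nn_integral_eq_integral int AE_I2 nonneg)
  finally have "L * (\<theta> x2 - \<theta> x1) \<le> (LBINT t:{\<epsilon><..<R}. sym_quot \<theta> x t)"
    by (subst (asm) ennreal_le_iff)
       (auto simp: set_lebesgue_integral_def intro!: Bochner_Integration.integral_nonneg nonneg[simplified])
  then show ?thesis by (simp add: L_def)
qed

section \<open>Bounds for the transform on an interval\<close>

text \<open>The bound on the truncated integrals does not depend on the cutoffs once
  \<open>\<epsilon>\<close> is small and \<open>R\<close> large, so it survives the limit.\<close>

lemma hilbert_transform_le:
  assumes "hilbert_well_defined \<theta>" "0 < x2" "x2 < x1" "x2 \<le> x" "x \<le> x1"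
  shows "pi * hilbert_transform \<theta> x \<le> - (ln ((x1 + x2) / (x1 - x2)) * (\<theta> x2 - \<theta> x1))"
proof -
  have "0 < 2 * x2 * (x1 - x2) / (x1 + x2)" using assms by simp
  then have "\<forall>\<^sub>F (\<epsilon>, R) in at_right 0 \<times>\<^sub>F at_top.
      ln ((x1 + x2) / (x1 - x2)) * (\<theta> x2 - \<theta> x1) \<le> (LBINT t:{\<epsilon><..<R}. sym_quot \<theta> x t)"
    unfolding eventually_prod_filter
    using eventually_at_right_real eventually_gt_at_top[of "2 * x1"]
    by (intro exI[of _ "\<lambda>\<epsilon>. \<epsilon> \<in> {0<..<2 * x2 * (x1 - x2) / (x1 + x2)}"]
          exI[of _ "\<lambda>R. 2 * x1 < R"]) (auto intro!: integral_sym_quot_ge assms)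
  then have "ln ((x1 + x2) / (x1 - x2)) * (\<theta> x2 - \<theta> x1) \<le> - pi * hilbert_transform \<theta> x"
    by (intro tendsto_lowerbound[OF hilbert_transform_limit[OF cont assms(1)]])
       (auto simp: prod_filter_eq_bot case_prod_unfold)
  then show ?thesis by simp
qed

text \<open>For \<open>t \<ge> c\<close> both \<open>\<theta> (x - t)\<close> and \<open>- \<theta> (x + t)\<close> increase with \<open>x \<in> {0..c}\<close>, so the tail at \<open>c\<close>
  controls all the others.\<close>

lemma hilbert_transform_bounded_below:
  assumes "hilbert_well_defined \<theta>" "0 \<le> c"
  shows "\<exists>B. \<forall>x\<in>{0..c}. B \<le> hilbert_transform \<theta> x"
proof -
  \<comment> \<open>This interval contains every \<open>x - t\<close> and \<open>x + t\<close> with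
    \<open>x\<close> and \<open>t\<close> in \<open>{0..c}\<close>.\<close>
  have "bounded (\<theta>' ` {-c..2*c})"
    using cont' by (intro compact_imp_bounded compact_continuous_image)
      (auto intro: continuous_on_subset)
  then obtain M where M: "0 < M" "\<And>z. z \<in> {-c..2*c} \<Longrightarrow> \<bar>\<theta>' z\<bar> \<le> M"
    unfolding bounded_pos by auto
  \<comment> \<open>For \<open>t \<le> c\<close> the mean value theorem gives the bound
    \<open>2 * M\<close>; beyond \<open>c\<close> monotonicity gives comparison with the quotient at
    \<open>c\<close>. Integrated, the indicator term contributes \<open>2 * M * c\<close> uniformly
    in both cutoffs.\<close>
  have pointwise: "sym_quot \<theta> x t \<le> 2 * M * indicator {0..c} t + sym_quot \<theta> c t"
    if "x \<in> {0..c}" "0 < t" for x t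
  proof (cases "t \<le> c")
    case True
    from MVT2[of "x - t" "x + t" \<theta> \<theta>'] deriv that obtain z where
      z: "x - t < z" "z < x + t" "\<theta> (x + t) - \<theta> (x - t) = 2 * t * \<theta>' z" by auto
    have "- \<theta>' z \<le> M" using M(2)[of z] z True that by auto
    then have "sym_quot \<theta> x t \<le> 2 * M"
      using z(3) that by (simp add: sym_quot_def field_simps)
    then show ?thesis using sym_quot_nonneg[of c t] True that assms by simp
  next
    case False
    then have "\<theta> (x - t) \<le> \<theta> (c - t)" "\<theta> (c + t) \<le> \<theta> (x + t)"
      using that by (auto intro!: antimono_abs)
    then show ?thesis using that False by (simp add: sym_quot_def divide_right_mono)
  qed
  have "- pi * hilbert_transform \<theta> x \<le> 2 * M * c + - pi * hilbert_transform \<theta> c"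
    if x: "x \<in> {0..c}" for x
  proof (rule tendsto_le)
    show "((\<lambda>(\<epsilon>, R). LBINT t:{\<epsilon><..<R}. sym_quot \<theta> x t) \<longlongrightarrow> - pi * hilbert_transform \<theta> x)
        (at_right 0 \<times>\<^sub>F at_top)"
      by (rule hilbert_transform_limit[OF cont assms(1)])
    show "((\<lambda>p. 2 * M * c + (case p of (\<epsilon>, R) \<Rightarrow> LBINT t:{\<epsilon><..<R}. sym_quot \<theta> c t)) \<longlongrightarrow>
        2 * M * c + - pi * hilbert_transform \<theta> c) (at_right 0 \<times>\<^sub>F at_top)"
      by (intro tendsto_intros hilbert_transform_limit[OF cont assms(1)])
    have "(LBINT t:{\<epsilon><..<R}. sym_quot \<theta> x t) \<le> 2 * M * c + (LBINT t:{\<epsilon><..<R}. sym_quot \<theta> c t)"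
      if "0 < \<epsilon>" for \<epsilon> R
    proof -
      have int1: "integrable lborel (\<lambda>t. 2 * M * indicator {0..c} t)"
        by (intro integrable_mult_right integrable_real_indicator) (auto simp: emeasure_lborel_Icc_eq)
      have int2: "integrable lborel (\<lambda>t. indicator {\<epsilon><..<R} t * sym_quot \<theta> y t)" for y
        using set_integrable_sym_quot[OF cont that] by (simp add: set_integrable_def)
      have "(LBINT t:{\<epsilon><..<R}. sym_quot \<theta> x t) \<le>
          (LBINT t. 2 * M * indicator {0..c} t + indicator {\<epsilon><..<R} t * sym_quot \<theta> c t)"
        unfolding set_lebesgue_integral_def real_scaleR_def
        using pointwise[OF x] that M(1)
        by (intro integral_mono int2 Bochner_Integration.integrable_add int1)
           (auto split: split_indicator)
      also have "\<dots> = 2 * M * c + (LBINT t:{\<epsilon><..<R}. sym_quot \<theta> c t)"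
        using assms by (subst Bochner_Integration.integral_add[OF int1 int2])
          (simp add: set_lebesgue_integral_def)
      finally show ?thesis .
    qed
    then show "\<forall>\<^sub>F p in at_right 0 \<times>\<^sub>F at_top.
        (case p of (\<epsilon>, R) \<Rightarrow> LBINT t:{\<epsilon><..<R}. sym_quot \<theta> x t) \<le>
        2 * M * c + (case p of (\<epsilon>, R) \<Rightarrow> LBINT t:{\<epsilon><..<R}. sym_quot \<theta> c t)"
      unfolding eventually_prod_filter
      by (intro exI[of _ "\<lambda>\<epsilon>. 0 < \<epsilon>"] exI[of _ "\<lambda>_. True"])
         (auto simp: eventually_at_right_less)
  qed (auto simp: prod_filter_eq_bot)
  then have "- (2 * M * c / pi) + hilbert_transform \<theta> c \<le> hilbert_transform \<theta> x" if "x \<in> {0..c}" for x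
    using that by (simp add: field_simps)
  then show ?thesis by blast
qed

section \<open>Integrability and the integrated inequality\<close>

lemma set_integrable_hilbert_transform_deriv:
  assumes "hilbert_well_defined \<theta>" "0 < a" "a < b"
  shows "set_integrable lborel {a..b} (\<lambda>x. hilbert_transform \<theta> x * \<theta>' x)"
proof -
  have [measurable]: "\<theta>' \<in> borel_measurable borel"
    using cont' by (rule borel_measurable_continuous_onI)
  note [measurable] = borel_measurable_hilbert_transform[OF cont assms(1)]
  obtain B where B: "\<And>x. x \<in> {0..b} \<Longrightarrow> B \<le> hilbert_transform \<theta> x"
    using hilbert_transform_bounded_below[of b] assms by fastforce
  have nonpos: "hilbert_transform \<theta> x \<le> 0" if "x \<in> {a..b}" for x
  proof -
    have "0 \<le> ln ((b + a) / (b - a)) * (\<theta> a - \<theta> b)"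
      using assms antimono_abs[of a b] by simp
    then have "pi * hilbert_transform \<theta> x \<le> 0"
      using hilbert_transform_le[OF assms(1), of a b x] that assms by auto
    then show ?thesis using mult_le_cancel_left_pos[OF pi_gt_zero, of _ 0] by simp
  qed
  \<comment> \<open>From \<open>B \<le> hilbert_transform \<theta> x \<le> 0\<close>, so the product
    is dominated by the continuous function \<open>B * \<theta>' x\<close> in absolute
    value.\<close>
  have bd: "\<bar>hilbert_transform \<theta> x\<bar> \<le> \<bar>B\<bar>" if "x \<in> {a..b}" for x
    using B[of x] nonpos[OF that] that assms(2) unfolding atLeastAtMost_iff by linarith
  show ?thesis
  proof (rule set_integrable_bound)
    show "set_integrable lborel {a..b} (\<lambda>x. B * \<theta>' x)"
      by (intro borel_integrable_atLeastAtMost' continuous_intros continuous_on_subset[OF cont']) auto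
    show "set_borel_measurable lborel {a..b} (\<lambda>x. hilbert_transform \<theta> x * \<theta>' x)"
      unfolding set_borel_measurable_def by measurable
    show "AE x in lborel. x \<in> {a..b} \<longrightarrow>
        norm (hilbert_transform \<theta> x * \<theta>' x) \<le> norm (B * \<theta>' x)"
      using bd by (auto simp: abs_mult intro!: mult_right_mono)
  qed
qed

text \<open>Multiplying the constant upper bound \<open>- C\<close> by
  \<open>\<theta>' x \<le> 0\<close> reverses it. The integral of \<open>- C * \<theta>' x\<close>
  is exact, and the second factor \<open>\<theta> x2 - \<theta> x1\<close> produces the
  square.\<close>

lemma integral_hilbert_transform_deriv_ge:
  assumes "hilbert_well_defined \<theta>" "0 < x2" "x2 < x1"
  shows "1 / pi * ln ((x1 + x2) / (x1 - x2)) * (\<theta> x2 - \<theta> x1)\<^sup>2 \<le>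
    (LBINT x:{x2..x1}. hilbert_transform \<theta> x * \<theta>' x)"
proof -
  define C where "C = 1 / pi * ln ((x1 + x2) / (x1 - x2)) * (\<theta> x2 - \<theta> x1)"
  have cont'': "continuous_on {x2..x1} \<theta>'"
    using cont' by (rule continuous_on_subset) simp
  have "(LBINT x:{x2..x1}. \<theta>' x) = \<theta> x1 - \<theta> x2"
    unfolding set_lebesgue_integral_def
  proof (rule integral_FTC_atLeastAtMost[OF _ _ cont''])
    show "(\<theta> has_vector_derivative \<theta>' x) (at x within {x2..x1})" for x
      using has_field_derivative_at_within[OF deriv]
      by (simp add: has_real_derivative_iff_has_vector_derivative)
  qed (use assms in simp)
  then have "(LBINT x:{x2..x1}. - C * \<theta>' x) = - C * (\<theta> x1 - \<theta> x2)"
    by (simp only: set_integral_mult_right)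
  also have "\<dots> = C * (\<theta> x2 - \<theta> x1)"
    by (simp add: algebra_simps)
  finally have "1 / pi * ln ((x1 + x2) / (x1 - x2)) * (\<theta> x2 - \<theta> x1)\<^sup>2 = (LBINT x:{x2..x1}. - C * \<theta>' x)"
    by (simp only: C_def power2_eq_square mult.assoc)
  also have "\<dots> \<le> (LBINT x:{x2..x1}. hilbert_transform \<theta> x * \<theta>' x)"
  proof (rule set_integral_mono)
    show "set_integrable lborel {x2..x1} (\<lambda>x. - C * \<theta>' x)"
      by (intro borel_integrable_atLeastAtMost' continuous_intros cont'')
    show "set_integrable lborel {x2..x1} (\<lambda>x. hilbert_transform \<theta> x * \<theta>' x)"
      using assms by (rule set_integrable_hilbert_transform_deriv)
    fix x assume "x \<in> {x2..x1}"
    then have "hilbert_transform \<theta> x \<le> - C" "\<theta>' x \<le> 0"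
      using hilbert_transform_le[OF assms, of x] deriv_nonpos[of x] assms
      by (auto simp: C_def field_simps)
    then show "- C * \<theta>' x \<le> hilbert_transform \<theta> x * \<theta>' x"
      by (rule mult_right_mono_neg)
  qed
  finally show ?thesis .
qed

end

section \<open>Smooth functions and the final estimate\<close>

lemma smooth_has_real_derivative:
  assumes "smooth f"
  shows "(f has_real_derivative deriv f x) (at x)"
proof -
  have "f differentiable (at x)"
    using assms[unfolded smooth_def, rule_format, of 0 x] by simp
  then show ?thesis
    by (simp only: DERIV_deriv_iff_real_differentiable)
qed

lemma smooth_continuous_on_deriv:
  assumes "smooth f"
  shows "continuous_on UNIV (deriv f)"
proof -
  have "deriv f differentiable (at x)" for x
    using assms[unfolded smooth_def, rule_format, of 1 x] by simp
  then show ?thesis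
    unfolding continuous_on_eq_continuous_at[OF open_UNIV]
    by (blast intro: differentiable_imp_continuous_within)
qed

theorem lemma4p2:
  fixes \<theta> :: "real \<Rightarrow> real" and x1 x2 :: real
  assumes "smooth \<theta>"
    and "\<And>x. \<theta> (- x) = \<theta> x"
    and "antimono_on {0<..} \<theta>"
    and "hilbert_well_defined \<theta>"
    and "0 < x2" and "x2 < x1"
  shows "(LBINT x:{x2..x1}. hilbert_transform \<theta> x * deriv \<theta> x)
           \<ge> 1 / (4 * pi) * ln ((x1 + x2) / (x1 - x2)) * (\<theta> x2 - \<theta> x1)\<^sup>2"
proof -
  interpret even_decreasing \<theta> "deriv \<theta>"
    by unfold_locales
       (use assms smooth_has_real_derivative smooth_continuous_on_deriv in auto)
  \<comment> \<open>With a nonnegative logarithm, the constant \<open>1 / pi\<close> may be lowered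
    to \<open>1 / (4 * pi)\<close>.\<close>
  have "0 \<le> ln ((x1 + x2) / (x1 - x2))"
    using assms(5,6) by simp
  then have "1 / (4 * pi) * ln ((x1 + x2) / (x1 - x2)) * (\<theta> x2 - \<theta> x1)\<^sup>2 \<le>
      1 / pi * ln ((x1 + x2) / (x1 - x2)) * (\<theta> x2 - \<theta> x1)\<^sup>2"
    by (intro mult_right_mono divide_left_mono) auto
  with integral_hilbert_transform_deriv_ge[OF assms(4-6)] show ?thesis
    by linarith
qed

end
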